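(* Let $C$ be a conjugation on a Hilbert space $\mathcal H$ and let $V$ be a $C$-symmetric isometric operator in $\mathcal H$ with $\operatorname{dom}V=\mathcal H_V$ a closed subspace of $\mathcal H$. Let $X_0$ be as defined in the context. (1) The formula $$\widetilde V_J=VP_{\mathcal H_V}+\left(X_0^*+CJP_{\ker X_0^*}\right)P_{\mathcal H_V^\perp}$$ gives a bijective correspondence between all conjugations $J$ in the subspace $\ker X_0^*\ (=\mathcal H_V^\perp\cap C\ker V^* )$ and all $C$-self-adjoint unitary extensions $\widetilde V_J$ of $V$ on $\mathcal H$. (2) If $$C\mathcal H_V^\perp\cap\ker V^*=\{0\},$$ then the unitary operator $\widetilde V=VP_{\mathcal H_V}+X_0^*P_{\mathcal H_V^\perp}$ is $C$-self-adjoint and $\widetilde V$ is the unique contractive extension of the adjoint pair $\{V,CVC\}$ of isometric operators.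
   Context: A conjugation on a Hilbert space is an anti-linear isometric operator $C$ on it with $C^2=I$. $V$ is $C$-symmetric if $(Vf,Cg)=(f,CVg)$ for all $f,g\in\mathcal H_V$. A bounded operator $B$ on $\mathcal H$ is $C$-self-adjoint if $B=CB^*C$. $\mathcal H_V^\perp:=\mathcal H\ominus\mathcal H_V$, $P_{\mathfrak M}$ is the orthogonal projection onto $\mathfrak M$, and $V^*:\mathcal H\to\mathcal H_V$ is the adjoint of the bounded operator $V:\mathcal H_V\to\mathcal H$; $\ker V^*=\mathcal H\ominus\operatorname{ran}V$. The map $P_{\ker V^*}Ch\mapsto P_{\mathcal H_V^\perp}CVh$, $h\in\mathcal H_V$, is a well-defined linear isometry; $X_0$ denotes its continuous extension, an isometry from $\mathcal L_0:=\overline{P_{\ker V^*}C\mathcal H_V}\subseteq\ker V^*$ into $\mathcal H_V^\perp$, and $X_0^*:\mathcal H_V^\perp\to\mathcal L_0$ is its adjoint. The operator $CVC$ is defined on $C\mathcal H_V$, and $\{V,CVC\}$ is an adjoint pair, i.e. $(Vf,h)=(f,CVCh)$ for $f\in\mathcal H_V$, $h\in C\mathcal H_V$. A contractive extension of $\{V,CVC\}$ is a contraction $\widetilde V$ defined on all of $\mathcal H$ with $\widetilde V\supset V$ and $\widetilde V^*\supset CVC$. *)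

theory Defs
  imports "HOL-Analysis.Analysis"
begin

section \<open>Complex Hilbert spaces\<close>

text \<open>
  The library has no complex inner product spaces.  They are introduced here on top of
  \<^class>\<open>real_inner\<close>: the norm and the topology are those of the real inner product, which is the
  real part of the complex one.  The complex inner product is linear in the first argument.
\<close>

class complex_inner = real_inner +
  fixes scaleC :: "complex \<Rightarrow> 'a \<Rightarrow> 'a" (infixr "*\<^sub>C" 75)
    and cinner :: "'a \<Rightarrow> 'a \<Rightarrow> complex"
  assumes scaleC_add_right: "a *\<^sub>C (x + y) = a *\<^sub>C x + a *\<^sub>C y"
    and scaleC_add_left: "(a + b) *\<^sub>C x = a *\<^sub>C x + b *\<^sub>C x"
    and scaleC_scaleC: "a *\<^sub>C b *\<^sub>C x = (a * b) *\<^sub>C x"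
    and scaleC_of_real: "complex_of_real r *\<^sub>C x = r *\<^sub>R x"
    and cinner_commute: "cinner x y = cnj (cinner y x)"
    and cinner_add_left: "cinner (x + y) z = cinner x z + cinner y z"
    and cinner_scaleC_left: "cinner (a *\<^sub>C x) y = a * cinner x y"
    and Re_cinner: "Re (cinner x y) = inner x y"

class chilbert_space = complex_inner + complete_space

instantiation complex :: chilbert_space
begin

definition scaleC_complex :: "complex \<Rightarrow> complex \<Rightarrow> complex" where
  "scaleC_complex a x = a * x"

definition cinner_complex :: "complex \<Rightarrow> complex \<Rightarrow> complex" where
  "cinner_complex x y = x * cnj y"

instance
  by standard
    (auto simp: scaleC_complex_def cinner_complex_def algebra_simps scaleR_conv_of_real
      inner_complex_def)

end

definition closed_csubspace :: "'a::complex_inner set \<Rightarrow> bool" where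
  "closed_csubspace M \<longleftrightarrow> closed M \<and> 0 \<in> M \<and> (\<forall>x\<in>M. \<forall>y\<in>M. x + y \<in> M) \<and> (\<forall>c. \<forall>x\<in>M. c *\<^sub>C x \<in> M)"

definition orth_compl :: "'a::complex_inner set \<Rightarrow> 'a set" where
  "orth_compl M = {x. \<forall>y\<in>M. cinner x y = 0}"

definition orth_proj :: "'a::complex_inner set \<Rightarrow> 'a \<Rightarrow> 'a" where
  "orth_proj M x = (THE y. y \<in> M \<and> x - y \<in> orth_compl M)"

section \<open>Operators\<close>

text \<open>
  An operator with domain \<open>D\<close> is represented by a total function of which only the values on \<open>D\<close>
  are used.
\<close>

definition clinear_on :: "'a::complex_inner set \<Rightarrow> ('a \<Rightarrow> 'a) \<Rightarrow> bool" where
  "clinear_on D T \<longleftrightarrow> (\<forall>x\<in>D. \<forall>y\<in>D. T (x + y) = T x + T y) \<and> (\<forall>c. \<forall>x\<in>D. T (c *\<^sub>C x) = c *\<^sub>C T x)"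

definition antilinear_on :: "'a::complex_inner set \<Rightarrow> ('a \<Rightarrow> 'a) \<Rightarrow> bool" where
  "antilinear_on D T \<longleftrightarrow>
     (\<forall>x\<in>D. \<forall>y\<in>D. T (x + y) = T x + T y) \<and> (\<forall>c. \<forall>x\<in>D. T (c *\<^sub>C x) = cnj c *\<^sub>C T x)"

definition isometric_on :: "'a::complex_inner set \<Rightarrow> ('a \<Rightarrow> 'a) \<Rightarrow> bool" where
  "isometric_on D T \<longleftrightarrow> clinear_on D T \<and> (\<forall>x\<in>D. norm (T x) = norm x)"

definition bounded_operator :: "('a::complex_inner \<Rightarrow> 'a) \<Rightarrow> bool" where
  "bounded_operator T \<longleftrightarrow> clinear_on UNIV T \<and> (\<exists>K. \<forall>x. norm (T x) \<le> K * norm x)"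

definition contraction :: "('a::complex_inner \<Rightarrow> 'a) \<Rightarrow> bool" where
  "contraction T \<longleftrightarrow> clinear_on UNIV T \<and> (\<forall>x. norm (T x) \<le> norm x)"

definition unitary :: "('a::complex_inner \<Rightarrow> 'a) \<Rightarrow> bool" where
  "unitary U \<longleftrightarrow> isometric_on UNIV U \<and> surj U"

text \<open>
  For \<open>T\<close> bounded on a closed subspace \<open>D\<close>, \<open>adjoint_on D T\<close> is the adjoint with values in \<open>D\<close>,
  that is \<open>(T f, g) = (f, T\<^sup>* g)\<close> for all \<open>f \<in> D\<close>.  If \<open>T\<close> is regarded as an operator from \<open>D\<close> into
  a closed subspace \<open>N\<close>, its adjoint is the restriction of \<open>adjoint_on D T\<close> to \<open>N\<close>.
\<close>

definition adjoint_on :: "'a::complex_inner set \<Rightarrow> ('a \<Rightarrow> 'a) \<Rightarrow> 'a \<Rightarrow> 'a" where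
  "adjoint_on D T g = (THE y. y \<in> D \<and> (\<forall>f\<in>D. cinner (T f) g = cinner f y))"

definition conjugation_on :: "'a::complex_inner set \<Rightarrow> ('a \<Rightarrow> 'a) \<Rightarrow> bool" where
  "conjugation_on M J \<longleftrightarrow>
     J ` M \<subseteq> M \<and> antilinear_on M J \<and> (\<forall>x\<in>M. norm (J x) = norm x) \<and> (\<forall>x\<in>M. J (J x) = x)"

definition C_symmetric_on :: "('a::complex_inner \<Rightarrow> 'a) \<Rightarrow> 'a set \<Rightarrow> ('a \<Rightarrow> 'a) \<Rightarrow> bool" where
  "C_symmetric_on C D V \<longleftrightarrow> (\<forall>f\<in>D. \<forall>g\<in>D. cinner (V f) (C g) = cinner f (C (V g)))"

definition C_self_adjoint :: "('a::complex_inner \<Rightarrow> 'a) \<Rightarrow> ('a \<Rightarrow> 'a) \<Rightarrow> bool" where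
  "C_self_adjoint C B \<longleftrightarrow> bounded_operator B \<and> B = C \<circ> adjoint_on UNIV B \<circ> C"

definition adjoint_pair ::
    "'a::complex_inner set \<Rightarrow> ('a \<Rightarrow> 'a) \<Rightarrow> 'a set \<Rightarrow> ('a \<Rightarrow> 'a) \<Rightarrow> bool" where
  "adjoint_pair D A E B \<longleftrightarrow> (\<forall>f\<in>D. \<forall>h\<in>E. cinner (A f) h = cinner f (B h))"

definition contractive_extension ::
    "'a::complex_inner set \<Rightarrow> ('a \<Rightarrow> 'a) \<Rightarrow> 'a set \<Rightarrow> ('a \<Rightarrow> 'a) \<Rightarrow> ('a \<Rightarrow> 'a) \<Rightarrow> bool" where
  "contractive_extension D A E B W \<longleftrightarrow>
     contraction W \<and> (\<forall>f\<in>D. W f = A f) \<and> (\<forall>h\<in>E. adjoint_on UNIV W h = B h)"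

section \<open>The isometry \<open>X\<^sub>0\<close>\<close>

definition ker_adjoint :: "'a::complex_inner set \<Rightarrow> ('a \<Rightarrow> 'a) \<Rightarrow> 'a set" where
  "ker_adjoint D V = {g. adjoint_on D V g = 0}"

definition L0 :: "('a::complex_inner \<Rightarrow> 'a) \<Rightarrow> 'a set \<Rightarrow> ('a \<Rightarrow> 'a) \<Rightarrow> 'a set" where
  "L0 C D V = closure ((\<lambda>h. orth_proj (ker_adjoint D V) (C h)) ` D)"

text \<open>Existence and uniqueness of the continuous extension are proved in \<open>X0_ex1\<close> below.\<close>

definition X0 :: "('a::complex_inner \<Rightarrow> 'a) \<Rightarrow> 'a set \<Rightarrow> ('a \<Rightarrow> 'a) \<Rightarrow> 'a \<Rightarrow> 'a" where
  "X0 C D V = (THE X. X \<in> extensional (L0 C D V) \<and> continuous_on (L0 C D V) X \<and>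
     (\<forall>h\<in>D. X (orth_proj (ker_adjoint D V) (C h)) = orth_proj (orth_compl D) (C (V h))))"

definition X0_adj :: "('a::complex_inner \<Rightarrow> 'a) \<Rightarrow> 'a set \<Rightarrow> ('a \<Rightarrow> 'a) \<Rightarrow> 'a \<Rightarrow> 'a" where
  "X0_adj C D V = adjoint_on (L0 C D V) (X0 C D V)"

definition ker_X0_adj :: "('a::complex_inner \<Rightarrow> 'a) \<Rightarrow> 'a set \<Rightarrow> ('a \<Rightarrow> 'a) \<Rightarrow> 'a set" where
  "ker_X0_adj C D V = {g \<in> orth_compl D. X0_adj C D V g = 0}"

definition V_ext ::
    "('a::complex_inner \<Rightarrow> 'a) \<Rightarrow> 'a set \<Rightarrow> ('a \<Rightarrow> 'a) \<Rightarrow> ('a \<Rightarrow> 'a) \<Rightarrow> 'a \<Rightarrow> 'a" where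
  "V_ext C D V J x =
     (let u = orth_proj (orth_compl D) x in
        V (orth_proj D x) + (X0_adj C D V u + C (J (orth_proj (ker_X0_adj C D V) u))))"

section \<open>Well-definedness\<close>

lemma scaleC_one: "1 *\<^sub>C x = (x::'a::complex_inner)"
  using scaleC_of_real[of 1 x] by simp

lemma scaleC_minus1: "(-1) *\<^sub>C x = - (x::'a::complex_inner)"
  using scaleC_of_real[of "-1" x] by simp

lemma cinner_add_right: "cinner x (y + z) = cinner x y + cinner x (z::'a::complex_inner)"
  by (metis cinner_commute cinner_add_left complex_cnj_add)

lemma cinner_scaleC_right: "cinner x (a *\<^sub>C y) = cnj a * cinner x (y::'a::complex_inner)"
  by (metis cinner_commute cinner_scaleC_left complex_cnj_mult)

lemma cinner_minus_left: "cinner (- x) y = - cinner x (y::'a::complex_inner)"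
  using cinner_scaleC_left[of "-1" x y] by (simp add: scaleC_minus1)

lemma cinner_minus_right: "cinner x (- y) = - cinner x (y::'a::complex_inner)"
  using cinner_scaleC_right[of x "-1" y] by (simp add: scaleC_minus1)

lemma cinner_diff_left: "cinner (x - y) z = cinner x z - cinner y (z::'a::complex_inner)"
  using cinner_add_left[of x "-y" z] by (simp add: cinner_minus_left)

lemma cinner_diff_right: "cinner x (y - z) = cinner x y - cinner x (z::'a::complex_inner)"
  using cinner_add_right[of x y "-z"] by (simp add: cinner_minus_right)

lemma cinner_zero_left [simp]: "cinner 0 (x::'a::complex_inner) = 0"
  using cinner_add_left[of 0 0 x] by simp

lemma cinner_zero_right [simp]: "cinner (x::'a::complex_inner) 0 = 0"
  using cinner_add_right[of x 0 0] by simp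

lemma cinner_self: "cinner x x = complex_of_real ((norm (x::'a::complex_inner))\<^sup>2)"
proof -
  have "Im (cinner x x) = 0"
    using arg_cong[OF cinner_commute[of x x], of Im] by simp
  thus ?thesis
    by (simp add: complex_eq_iff Re_cinner power2_norm_eq_inner)
qed

lemma cinner_eq_zero_iff [simp]: "cinner x x = 0 \<longleftrightarrow> (x::'a::complex_inner) = 0"
  by (simp add: cinner_self)

lemma Im_cinner: "Im (cinner x y) = inner x (\<i> *\<^sub>C (y::'a::complex_inner))"
  using Re_cinner[of x "\<i> *\<^sub>C y"] by (simp add: cinner_scaleC_right)

lemma norm_scaleC: "norm (a *\<^sub>C x) = cmod a * norm (x::'a::complex_inner)"
proof -
  have "complex_of_real ((norm (a *\<^sub>C x))\<^sup>2) = complex_of_real ((cmod a * norm x)\<^sup>2)"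
    by (simp only: cinner_self[symmetric] cinner_scaleC_left cinner_scaleC_right)
       (use complex_norm_square[of a] in
         \<open>simp add: cinner_self power_mult_distrib mult.commute[of "cnj a"] flip: mult.assoc\<close>)
  hence "(norm (a *\<^sub>C x))\<^sup>2 = (cmod a * norm x)\<^sup>2"
    using of_real_eq_iff by blast
  thus ?thesis by (simp add: power2_eq_iff_nonneg)
qed

lemma scaleC_diff_right: "a *\<^sub>C (x - y) = a *\<^sub>C x - a *\<^sub>C (y::'a::complex_inner)"
  using scaleC_add_right[of a "x - y" y] by (simp add: algebra_simps)

lemma norm_scaleC_diff: "norm (a *\<^sub>C x - a *\<^sub>C y) = cmod a * norm (x - (y::'a::complex_inner))"
  by (simp add: norm_scaleC flip: scaleC_diff_right)

lemma bounded_linear_scaleC: "bounded_linear (\<lambda>x::'a::complex_inner. a *\<^sub>C x)"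
proof (rule bounded_linear_intro[where K = "cmod a"])
  fix r :: real and x :: 'a
  show "a *\<^sub>C r *\<^sub>R x = r *\<^sub>R a *\<^sub>C x"
    by (simp add: scaleC_scaleC mult.commute flip: scaleC_of_real)
qed (simp_all add: scaleC_add_right norm_scaleC mult.commute)

lemma continuous_on_cinner_left: "continuous_on S (\<lambda>x. cinner x (y::'a::complex_inner))"
proof -
  have "(\<lambda>x. cinner x y) = (\<lambda>x. Complex (inner x y) (inner x (\<i> *\<^sub>C y)))"
    by (auto simp: complex_eq_iff Re_cinner Im_cinner)
  moreover have "continuous_on S (\<lambda>x. Complex (inner x y) (inner x (\<i> *\<^sub>C y)))"
    unfolding Complex_eq by (intro continuous_intros)
  ultimately show ?thesis by metis
qed

lemma orth_norm_add:
  assumes "cinner x (y::'a::complex_inner) = 0"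
  shows "(norm (x + y))\<^sup>2 = (norm x)\<^sup>2 + (norm y)\<^sup>2"
proof -
  have "inner x y = 0" using assms Re_cinner[of x y] by simp
  thus ?thesis by (simp add: power2_norm_eq_inner inner_add_left inner_add_right inner_commute)
qed

lemma closed_csubspace_diff:
  "closed_csubspace M \<Longrightarrow> x \<in> M \<Longrightarrow> y \<in> M \<Longrightarrow> x - y \<in> M"
  unfolding closed_csubspace_def by (metis scaleC_minus1 add_uminus_conv_diff)

lemma closed_csubspace_scaleR:
  "closed_csubspace M \<Longrightarrow> x \<in> M \<Longrightarrow> r *\<^sub>R x \<in> M"
  unfolding closed_csubspace_def by (metis scaleC_of_real)

lemma closed_csubspace_UNIV: "closed_csubspace UNIV"
  by (simp add: closed_csubspace_def)

lemma closed_csubspace_orth_compl: "closed_csubspace (orth_compl M)"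
proof -
  have "orth_compl M = (\<Inter>y\<in>M. (\<lambda>x. cinner x y) -` {0})"
    by (auto simp: orth_compl_def)
  moreover have "closed ((\<lambda>x. cinner x y) -` {0})" for y :: 'a
    by (intro closed_vimage continuous_on_cinner_left) auto
  ultimately have "closed (orth_compl M)" by auto
  thus ?thesis
    by (auto simp: closed_csubspace_def orth_compl_def cinner_add_left cinner_scaleC_left)
qed

lemma orth_proj_ex:
  fixes M :: "'a::chilbert_space set"
  assumes M: "closed_csubspace M"
  shows "\<exists>y. y \<in> M \<and> x - y \<in> orth_compl M"
proof -
  define d where "d = infdist x M"
  have ne: "M \<noteq> {}" and M0: "0 \<in> M" using M by (auto simp: closed_csubspace_def)
  have d0: "d \<ge> 0" by (simp add: d_def infdist_nonneg)
  have "\<exists>y\<in>M. dist x y < d + inverse (real (Suc n))" for n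
  proof -
    have "(INF a\<in>M. dist x a) < d + inverse (real (Suc n))"
      using ne by (simp add: d_def infdist_notempty)
    thus ?thesis
      by (subst (asm) cINF_less_iff) (use ne in auto)
  qed
  then obtain y where yM: "\<And>n. y n \<in> M" and yd: "\<And>n. dist x (y n) < d + inverse (real (Suc n))"
    by metis
  have dle: "d \<le> norm (x - z)" if "z \<in> M" for z
    using infdist_le[OF that, of x] by (simp add: d_def dist_norm)
  have est: "(norm (y m - y n))\<^sup>2 \<le> (4 * d + 2) * (inverse (real (Suc m)) + inverse (real (Suc n)))" for m n
  proof -
    let ?a = "x - y m" and ?b = "x - y n"
    let ?p = "inverse (real (Suc m))" and ?q = "inverse (real (Suc n))"
    have sq: "(d + t)\<^sup>2 \<le> d\<^sup>2 + (2 * d + 1) * t" if "0 \<le> t" "t \<le> 1" for t :: real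
    proof -
      have "t * t \<le> t" using that by (simp add: mult_left_le)
      thus ?thesis by (simp add: power2_eq_square algebra_simps)
    qed
    have par: "(norm (?a - ?b))\<^sup>2 = 2 * (norm ?a)\<^sup>2 + 2 * (norm ?b)\<^sup>2 - (norm (?a + ?b))\<^sup>2"
      by (simp only: power2_norm_eq_inner inner_add_left inner_add_right inner_diff_left
          inner_diff_right) (simp add: inner_commute)
    have mid: "(1/2) *\<^sub>R (y m + y n) \<in> M"
      using M yM by (intro closed_csubspace_scaleR) (auto simp: closed_csubspace_def)
    have "?a + ?b = 2 *\<^sub>R (x - (1/2) *\<^sub>R (y m + y n))"
      by (simp add: algebra_simps scaleR_2)
    hence "norm (?a + ?b) = 2 * norm (x - (1/2) *\<^sub>R (y m + y n))" by simp
    with dle[OF mid] have "norm (?a + ?b) \<ge> 2 * d" by linarith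
    hence s: "(norm (?a + ?b))\<^sup>2 \<ge> 4 * d\<^sup>2"
      using power_mono[of "2*d" "norm (?a + ?b)" 2] d0 by (simp add: power_mult_distrib)
    have p: "0 \<le> ?p" "?p \<le> 1" "0 \<le> ?q" "?q \<le> 1" by (auto simp: field_simps)
    have a: "(norm ?a)\<^sup>2 \<le> d\<^sup>2 + (2 * d + 1) * ?p"
      using power_mono[OF less_imp_le[OF yd[of m]], of 2] sq[OF p(1,2)] by (simp add: dist_norm)
    have b: "(norm ?b)\<^sup>2 \<le> d\<^sup>2 + (2 * d + 1) * ?q"
      using power_mono[OF less_imp_le[OF yd[of n]], of 2] sq[OF p(3,4)] by (simp add: dist_norm)
    have "norm (?a - ?b) = norm (y m - y n)" by (simp add: norm_minus_commute)
    with par have "(norm (y m - y n))\<^sup>2 = 2 * (norm ?a)\<^sup>2 + 2 * (norm ?b)\<^sup>2 - (norm (?a + ?b))\<^sup>2"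
      by simp
    also have "\<dots> \<le> 2 * (d\<^sup>2 + (2 * d + 1) * ?p) + 2 * (d\<^sup>2 + (2 * d + 1) * ?q) - 4 * d\<^sup>2"
      by (intro diff_mono add_mono mult_left_mono) (use a b s in auto)
    also have "\<dots> = (4 * d + 2) * (?p + ?q)" by (simp add: algebra_simps)
    finally show ?thesis .
  qed
  have "Cauchy y"
  proof (rule CauchyI)
    fix e :: real assume e: "e > 0"
    define k where "k = e\<^sup>2 / (2 * (4 * d + 2))"
    have c: "4 * d + 2 > 0" using d0 by simp
    have "k > 0" using e c by (simp add: k_def)
    then obtain N where N: "inverse (real (Suc N)) < k" using reals_Archimedean by blast
    show "\<exists>N. \<forall>m\<ge>N. \<forall>n\<ge>N. norm (y m - y n) < e"
    proof (intro exI allI impI)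
      fix m n assume mn: "m \<ge> N" "n \<ge> N"
      have "inverse (real (Suc j)) < k" if "j \<ge> N" for j
        by (rule le_less_trans[OF le_imp_inverse_le N]) (use that in auto)
      from this[OF mn(1)] this[OF mn(2)]
      have "inverse (real (Suc m)) + inverse (real (Suc n)) < 2 * k" by simp
      hence "(4 * d + 2) * (inverse (real (Suc m)) + inverse (real (Suc n))) < (4 * d + 2) * (2 * k)"
        using c by (rule mult_strict_left_mono)
      also have "\<dots> = e\<^sup>2"
      proof -
        have "r * (2 * (t / (2 * r))) = t" if "r \<noteq> 0" for r t :: real using that by simp
        from this[of "4 * d + 2" "e\<^sup>2"] c show ?thesis unfolding k_def by (metis less_irrefl)
      qed
      finally have "(norm (y m - y n))\<^sup>2 < e\<^sup>2" using est[of m n] by linarith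
      thus "norm (y m - y n) < e" using e power2_less_imp_less by fastforce
    qed
  qed
  then obtain l where l: "y \<longlonglongrightarrow> l" using Cauchy_convergent convergent_def by blast
  have lM: "l \<in> M"
    using M yM l closed_sequentially unfolding closed_csubspace_def by blast
  have "dist x l \<le> d + 0"
    by (rule LIMSEQ_le[OF tendsto_dist[OF tendsto_const l]
          tendsto_add[OF tendsto_const LIMSEQ_inverse_real_of_nat]])
       (use yd less_imp_le in blast)
  hence min: "\<forall>z\<in>M. dist x l \<le> dist x z"
    using dle by (fastforce simp: dist_norm)
  have conv: "convex M"
    using M closed_csubspace_scaleR[OF M]
    unfolding closed_csubspace_def convex_def by blast
  have le: "inner (x - l) z \<le> 0" if z: "z \<in> M" for z
  proof -
    have "l + z \<in> M" using M lM z by (auto simp: closed_csubspace_def)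
    from any_closest_point_dot[OF conv _ lM this min] M show ?thesis
      by (simp add: closed_csubspace_def)
  qed
  have re: "inner (x - l) z = 0" if z: "z \<in> M" for z
    using le[OF z] le[OF closed_csubspace_scaleR[OF M z, of "-1"]] by simp
  have "cinner (x - l) z = 0" if z: "z \<in> M" for z
  proof -
    have "\<i> *\<^sub>C z \<in> M" using M z by (auto simp: closed_csubspace_def)
    thus ?thesis using re[OF z] re[of "\<i> *\<^sub>C z"] by (simp add: complex_eq_iff Re_cinner Im_cinner)
  qed
  thus ?thesis using lM by (auto simp: orth_compl_def)
qed

lemma orth_proj_eq:
  assumes "closed_csubspace M" "y \<in> M" "x - y \<in> orth_compl M"
  shows "orth_proj M x = y"
  unfolding orth_proj_def
proof (rule the_equality)
  fix z assume z: "z \<in> M \<and> x - z \<in> orth_compl M"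
  have d: "z - y \<in> M" using assms z closed_csubspace_diff by blast
  have "cinner (x - y) (z - y) = 0" "cinner (x - z) (z - y) = 0"
    using d z assms by (auto simp: orth_compl_def)
  moreover have "z - y = (x - y) - (x - z)" by simp
  ultimately have "cinner (z - y) (z - y) = 0" by (metis cinner_diff_left diff_self)
  thus "z = y" by simp
qed (use assms in auto)

lemma orth_proj_props:
  fixes M :: "'a::chilbert_space set"
  assumes "closed_csubspace M"
  shows "orth_proj M x \<in> M" "x - orth_proj M x \<in> orth_compl M"
  using orth_proj_ex[OF assms, of x] orth_proj_eq[OF assms] by metis+

text \<open>Riesz representation, in the form needed for \<^const>\<open>adjoint_on\<close>.\<close>

lemma adjoint_on_ex:
  fixes D :: "'a::chilbert_space set"
  assumes D: "closed_csubspace D" and lin: "clinear_on D T"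
    and bd: "\<forall>x\<in>D. norm (T x) \<le> K * norm x"
  shows "\<exists>y. y \<in> D \<and> (\<forall>f\<in>D. cinner (T f) g = cinner f y)"
proof (cases "\<forall>f\<in>D. cinner (T f) g = 0")
  case True
  thus ?thesis using D by (intro exI[of _ 0]) (auto simp: closed_csubspace_def)
next
  case False
  then obtain u where u: "u \<in> D" "cinner (T u) g \<noteq> 0" by blast
  define N where "N = {x \<in> D. cinner (T x) g = 0}"
  have Tdiff: "T (x - y) = T x - T y" if "x \<in> D" "y \<in> D" for x y
  proof -
    have "T ((x - y) + y) = T (x - y) + T y"
      using lin that closed_csubspace_diff[OF D that] unfolding clinear_on_def by blast
    thus ?thesis by simp
  qed
  have "continuous_on D T"
  proof (rule continuous_onI)
    fix x and e :: real assume x: "x \<in> D" and "e > 0"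
    define k where "k = \<bar>K\<bar> + 1"
    have k: "k > 0" by (simp add: k_def)
    show "\<exists>d>0. \<forall>x'\<in>D. dist x' x < d \<longrightarrow> dist (T x') (T x) \<le> e"
    proof (intro exI conjI ballI impI)
      show "e / k > 0" using k \<open>e > 0\<close> by simp
      fix x' assume x': "x' \<in> D" "dist x' x < e / k"
      have "norm (T x' - T x) \<le> K * norm (x' - x)"
        using bd closed_csubspace_diff[OF D x'(1) x] Tdiff[OF x'(1) x] by metis
      also have "\<dots> \<le> k * norm (x' - x)"
        by (intro mult_right_mono) (auto simp: k_def)
      also have "\<dots> \<le> e" using x' k by (simp add: dist_norm field_simps)
      finally show "dist (T x') (T x) \<le> e" by (simp add: dist_norm)
    qed
  qed
  hence "continuous_on D (\<lambda>x. cinner (T x) g)"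
    using continuous_on_compose2[OF continuous_on_cinner_left[of UNIV g]] by blast
  hence "closed N"
    unfolding N_def using D continuous_closed_preimage_constant
    by (fastforce simp: closed_csubspace_def)
  moreover have "T 0 = 0"
    using Tdiff[of 0 0] D by (simp add: closed_csubspace_def)
  ultimately have N: "closed_csubspace N"
    using D lin unfolding closed_csubspace_def clinear_on_def N_def
    by (auto simp: cinner_add_left cinner_scaleC_left)
  define z where "z = u - orth_proj N u"
  have pN: "orth_proj N u \<in> N" and zN: "z \<in> orth_compl N"
    using orth_proj_props[OF N] by (auto simp: z_def)
  have zD: "z \<in> D"
    using closed_csubspace_diff[OF D u(1)] pN by (auto simp: z_def N_def)
  have fz: "cinner (T z) g = cinner (T u) g"
    using pN Tdiff[OF u(1)] by (auto simp: z_def N_def cinner_diff_left)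
  have zz: "cinner z z \<noteq> 0"
    using fz u \<open>T 0 = 0\<close> by auto
  define a where "a = cnj (cinner (T z) g / cinner z z)"
  have "cinner (T f) g = cinner f (a *\<^sub>C z)" if f: "f \<in> D" for f
  proof -
    define b where "b = cinner (T f) g / cinner (T z) g"
    have bz: "b *\<^sub>C z \<in> D" using D zD by (auto simp: closed_csubspace_def)
    have "T (b *\<^sub>C z) = b *\<^sub>C T z" using lin zD by (auto simp: clinear_on_def)
    hence "cinner (T (f - b *\<^sub>C z)) g = 0"
      using Tdiff[OF f bz] fz u by (simp add: cinner_diff_left cinner_scaleC_left b_def)
    hence "f - b *\<^sub>C z \<in> N" using closed_csubspace_diff[OF D f bz] by (simp add: N_def)
    hence "cinner z (f - b *\<^sub>C z) = 0" using zN by (simp add: orth_compl_def)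
    hence "cinner (f - b *\<^sub>C z) z = 0" by (metis cinner_commute complex_cnj_zero)
    hence "cinner f z = b * cinner z z" by (simp add: cinner_diff_left cinner_scaleC_left)
    thus ?thesis using zz fz u by (simp add: cinner_scaleC_right a_def b_def)
  qed
  moreover have "a *\<^sub>C z \<in> D" using D zD by (auto simp: closed_csubspace_def)
  ultimately show ?thesis by blast
qed

lemma adjoint_on_eq:
  assumes D: "closed_csubspace D" and y: "y \<in> D" "\<forall>f\<in>D. cinner (T f) g = cinner f y"
  shows "adjoint_on D T g = y"
  unfolding adjoint_on_def
proof (rule the_equality)
  fix z assume z: "z \<in> D \<and> (\<forall>f\<in>D. cinner (T f) g = cinner f z)"
  have d: "z - y \<in> D" using closed_csubspace_diff[OF D] z y by blast
  hence "cinner (z - y) z = cinner (z - y) y" using z y by metis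
  hence "cinner (z - y) (z - y) = 0" by (simp add: cinner_diff_right)
  thus "z = y" by simp
qed (use y in auto)

lemma adjoint_on_props:
  fixes D :: "'a::chilbert_space set"
  assumes "closed_csubspace D" "clinear_on D T" "\<forall>x\<in>D. norm (T x) \<le> K * norm x"
  shows "adjoint_on D T g \<in> D" "f \<in> D \<Longrightarrow> cinner (T f) g = cinner f (adjoint_on D T g)"
  using adjoint_on_ex[OF assms, of g] adjoint_on_eq[OF assms(1)] by metis+

lemma ker_adjoint_eq:
  fixes D :: "'a::chilbert_space set"
  assumes D: "closed_csubspace D" and V: "isometric_on D V"
  shows "ker_adjoint D V = orth_compl (V ` D)"
proof -
  have b: "clinear_on D V" "\<forall>x\<in>D. norm (V x) \<le> 1 * norm x"
    using V by (auto simp: isometric_on_def)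
  have "adjoint_on D V g = 0 \<longleftrightarrow> (\<forall>f\<in>D. cinner (V f) g = 0)" for g
  proof
    show "\<forall>f\<in>D. cinner (V f) g = 0" if "adjoint_on D V g = 0"
      using adjoint_on_props(2)[OF D b] that by simp
    show "adjoint_on D V g = 0" if "\<forall>f\<in>D. cinner (V f) g = 0"
      by (rule adjoint_on_eq[OF D]) (use that D in \<open>auto simp: closed_csubspace_def\<close>)
  qed
  moreover have "cinner g (V f) = 0 \<longleftrightarrow> cinner (V f) g = 0" for f g
    by (metis cinner_commute complex_cnj_zero)
  ultimately show ?thesis by (auto simp: ker_adjoint_def orth_compl_def)
qed

lemma isometric_on_cinner:
  assumes D: "closed_csubspace D" and V: "isometric_on D V" and xy: "x \<in> D" "y \<in> D"
  shows "cinner (V x) (V y) = cinner x y"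
proof -
  have re: "inner (V x) (V y) = inner x y" if "x \<in> D" "y \<in> D" for x y
  proof -
    have "x + y \<in> D" "V (x + y) = V x + V y"
      using D V that by (auto simp: closed_csubspace_def isometric_on_def clinear_on_def)
    hence "norm (V x + V y) = norm (x + y)" "norm (V x) = norm x" "norm (V y) = norm y"
      using V that unfolding isometric_on_def by metis+
    thus ?thesis by (simp add: dot_norm)
  qed
  have "\<i> *\<^sub>C y \<in> D" "V (\<i> *\<^sub>C y) = \<i> *\<^sub>C V y"
    using D V xy by (auto simp: closed_csubspace_def isometric_on_def clinear_on_def)
  thus ?thesis using re[OF xy] re[of x "\<i> *\<^sub>C y"] xy
    by (simp add: complex_eq_iff Re_cinner Im_cinner)
qed

lemma conjugation_on_cinner:
  assumes D: "closed_csubspace M" and J: "conjugation_on M J" and xy: "x \<in> M" "y \<in> M"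
  shows "cinner (J x) (J y) = cinner y x"
proof -
  have re: "inner (J x) (J y) = inner x y" if "x \<in> M" "y \<in> M" for x y
  proof -
    have "x + y \<in> M" "J (x + y) = J x + J y"
      using D J that by (auto simp: closed_csubspace_def conjugation_on_def antilinear_on_def)
    hence "norm (J x + J y) = norm (x + y)" "norm (J x) = norm x" "norm (J y) = norm y"
      using J that unfolding conjugation_on_def by metis+
    thus ?thesis by (simp add: dot_norm)
  qed
  have i: "\<i> *\<^sub>C y \<in> M" "J (\<i> *\<^sub>C y) = - (\<i> *\<^sub>C J y)"
    using D J xy scaleC_scaleC[of "-1" "\<i>" "J y"]
    by (auto simp: closed_csubspace_def conjugation_on_def antilinear_on_def scaleC_minus1)
  have "Im (cinner (J x) (J y)) = - Im (cinner x y)"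
    using re[OF xy(1) i(1)] i by (simp add: Im_cinner)
  also have "\<dots> = Im (cinner y x)" using arg_cong[OF cinner_commute[of x y], of Im] by simp
  finally show ?thesis using re[OF xy]
    by (simp add: complex_eq_iff Re_cinner inner_commute)
qed

lemma adjoint_pair_V_CVC:
  assumes C: "conjugation_on UNIV C" and V: "C_symmetric_on C D V"
  shows "adjoint_pair D V (C ` D) (C \<circ> V \<circ> C)"
  using assms by (auto simp: adjoint_pair_def C_symmetric_on_def conjugation_on_def)

lemma X0_ex1:
  fixes D :: "'a::chilbert_space set"
  assumes C: "conjugation_on UNIV C" and D: "closed_csubspace D"
    and V: "isometric_on D V" and sym: "C_symmetric_on C D V"
  shows "\<exists>!X. X \<in> extensional (L0 C D V) \<and> continuous_on (L0 C D V) X \<and>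
    (\<forall>h\<in>D. X (orth_proj (ker_adjoint D V) (C h)) = orth_proj (orth_compl D) (C (V h)))"
    and "isometric_on (L0 C D V) (X0 C D V)"
    and "X0 C D V ` L0 C D V \<subseteq> orth_compl D"
    and "L0 C D V \<subseteq> ker_adjoint D V"
    and "closed_csubspace (L0 C D V)"
    and "\<And>h. h \<in> D \<Longrightarrow>
      X0 C D V (orth_proj (ker_adjoint D V) (C h)) = orth_proj (orth_compl D) (C (V h))"
proof -
  define K where "K = ker_adjoint D V"
  define A where "A h = orth_proj K (C h)" for h
  define B where "B h = orth_proj (orth_compl D) (C (V h))" for h
  define S where "S = A ` D"
  have L0: "L0 C D V = closure S" by (simp add: L0_def S_def A_def K_def)
  have K: "closed_csubspace K" "K = orth_compl (V ` D)"
    unfolding K_def ker_adjoint_eq[OF D V] by (simp_all add: closed_csubspace_orth_compl)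
  have b: "clinear_on D V" "\<forall>x\<in>D. norm (V x) \<le> 1 * norm x"
    using V by (auto simp: isometric_on_def)
  have Vadd: "V (x + y) = V x + V y" "V (c *\<^sub>C x) = c *\<^sub>C V x" if "x \<in> D" "y \<in> D" for x y c
    using b that by (auto simp: clinear_on_def)
  have Cadd: "C (x + y) = C x + C y" "C (c *\<^sub>C x) = cnj c *\<^sub>C C x" "norm (C x) = norm x" for x y c
    using C by (auto simp: conjugation_on_def antilinear_on_def)
  have Dadd: "x + y \<in> D" "c *\<^sub>C x \<in> D" if "x \<in> D" "y \<in> D" for x y c
    using D that by (auto simp: closed_csubspace_def)
  define Vs where "Vs h = adjoint_on D V (C h)" for h
  have Vs: "Vs h \<in> D" "f \<in> D \<Longrightarrow> cinner (V f) (C h) = cinner f (Vs h)" for f h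
    using adjoint_on_props[OF D b] by (auto simp: Vs_def)
  have Aeq: "A h = C h - V (Vs h)" for h
    unfolding A_def
  proof (rule orth_proj_eq[OF K(1)])
    have "cinner (V f) (C h - V (Vs h)) = 0" if "f \<in> D" for f
      using isometric_on_cinner[OF D V that Vs(1)] Vs(2)[OF that]
      by (simp add: cinner_diff_right)
    thus "C h - V (Vs h) \<in> K"
      unfolding K(2) orth_compl_def by (auto) (metis cinner_commute complex_cnj_zero)
    have "cinner (V (Vs h)) y = 0" if "y \<in> K" for y
      using that Vs(1)[of h] unfolding K(2) orth_compl_def
      by auto (metis cinner_commute complex_cnj_zero)
    thus "C h - (C h - V (Vs h)) \<in> orth_compl K" by (simp add: orth_compl_def)
  qed
  have Beq: "B h = C (V h) - Vs h" if h: "h \<in> D" for h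
    unfolding B_def
  proof (rule orth_proj_eq[OF closed_csubspace_orth_compl])
    have "cinner f (C (V h) - Vs h) = 0" if "f \<in> D" for f
      using sym that h Vs(2)[OF that, of h] by (simp add: C_symmetric_on_def cinner_diff_right)
    thus "C (V h) - Vs h \<in> orth_compl D"
      unfolding orth_compl_def by (auto) (metis cinner_commute complex_cnj_zero)
    show "C (V h) - (C (V h) - Vs h) \<in> orth_compl (orth_compl D)"
      using Vs(1)[of h] unfolding orth_compl_def
      by auto (metis cinner_commute complex_cnj_zero)
  qed
  have AK: "A h \<in> K" for h using orth_proj_props[OF K(1)] by (simp add: A_def)
  have BD: "B h \<in> orth_compl D" for h
    using orth_proj_props[OF closed_csubspace_orth_compl] by (simp add: B_def)
  have nAB: "norm (A h) = norm (B h)" if h: "h \<in> D" for h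
  proof -
    have "cinner (A h) (V (Vs h)) = 0" using AK[of h] Vs(1) by (auto simp: K(2) orth_compl_def)
    from orth_norm_add[OF this] have 1: "(norm h)\<^sup>2 = (norm (A h))\<^sup>2 + (norm (Vs h))\<^sup>2"
      using V Vs(1)[of h] by (simp add: Aeq Cadd isometric_on_def)
    have "cinner (B h) (Vs h) = 0" using BD[of h] Vs(1) by (auto simp: orth_compl_def)
    from orth_norm_add[OF this] have 2: "(norm h)\<^sup>2 = (norm (B h))\<^sup>2 + (norm (Vs h))\<^sup>2"
      using V h by (simp add: Beq[OF h] Cadd isometric_on_def)
    from 1 2 have "(norm (A h))\<^sup>2 = (norm (B h))\<^sup>2" by simp
    thus ?thesis by (simp add: power2_eq_iff_nonneg)
  qed
  have Vsadd: "Vs (x + y) = Vs x + Vs y" "Vs (c *\<^sub>C x) = cnj c *\<^sub>C Vs x" for x y c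
  proof -
    have "adjoint_on D V (C (x + y)) = Vs x + Vs y"
      by (rule adjoint_on_eq[OF D])
         (use Vs(2) in \<open>simp_all add: Dadd(1)[OF Vs(1) Vs(1)] Cadd cinner_add_right\<close>)
    thus "Vs (x + y) = Vs x + Vs y" by (simp only: Vs_def)
    have "adjoint_on D V (C (c *\<^sub>C x)) = cnj c *\<^sub>C Vs x"
      by (rule adjoint_on_eq[OF D])
         (use Vs(2) in \<open>simp_all add: Dadd(2)[OF Vs(1) Vs(1)] Cadd cinner_scaleC_right\<close>)
    thus "Vs (c *\<^sub>C x) = cnj c *\<^sub>C Vs x" by (simp only: Vs_def)
  qed
  have Aadd: "A (x + y) = A x + A y" "A (c *\<^sub>C x) = cnj c *\<^sub>C A x" if "x \<in> D" "y \<in> D" for x y c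
    using that by (simp_all add: Aeq Vsadd Vadd Vs Cadd scaleC_diff_right)
  have Badd: "B (x + y) = B x + B y" "B (c *\<^sub>C x) = cnj c *\<^sub>C B x" if "x \<in> D" "y \<in> D" for x y c
    using that by (simp_all add: Beq Dadd Vsadd Vadd Cadd scaleC_diff_right)
  have diff: "norm (A x - A y) = norm (B x - B y)" if "x \<in> D" "y \<in> D" for x y
  proof -
    have d: "x - y \<in> D" using closed_csubspace_diff[OF D that] .
    have "A x - A y = A (x - y)" "B x - B y = B (x - y)"
      using Aadd(1)[OF d that(2)] Badd(1)[OF d that(2)] by simp_all
    thus ?thesis using nAB[OF d] by simp
  qed
  define F where "F = B \<circ> inv_into D A"
  have F: "F (A h) = B h" if h: "h \<in> D" for h
  proof -
    let ?k = "inv_into D A (A h)"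
    have "?k \<in> D" "A ?k = A h" using h by (auto intro: inv_into_into f_inv_into_f)
    thus ?thesis using diff[of ?k h] h by (simp add: F_def)
  qed
  have "dist (F x) (F y) = dist x y" if "x \<in> S" "y \<in> S" for x y
    using that diff by (auto simp: S_def F dist_norm)
  hence "uniformly_continuous_on S F" unfolding uniformly_continuous_on_def by metis
  then obtain G where G: "uniformly_continuous_on (closure S) G" "\<And>x. x \<in> S \<Longrightarrow> F x = G x"
    "\<And>X x. continuous_on (closure S) X \<Longrightarrow> \<forall>x\<in>S. F x = X x \<Longrightarrow> x \<in> closure S \<Longrightarrow> X x = G x"
  proof (rule uniformly_continuous_on_extension_on_closure)
    fix g
    assume g: "uniformly_continuous_on (closure S) g" "\<And>x. x \<in> S \<Longrightarrow> F x = g x"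
      "\<And>Y h x. S \<subseteq> Y \<Longrightarrow> Y \<subseteq> closure S \<Longrightarrow> continuous_on Y h \<Longrightarrow>
         (\<And>x. x \<in> S \<Longrightarrow> F x = h x) \<Longrightarrow> x \<in> Y \<Longrightarrow> h x = g x"
    show thesis
      by (rule that[OF g(1,2)], assumption, rule g(3)[OF closure_subset order_refl]) blast+
  qed
  have Gc: "continuous_on (closure S) G" using G(1) uniformly_continuous_imp_continuous by blast
  have GA: "G (A h) = B h" "A h \<in> closure S" if "h \<in> D" for h
  proof -
    have "A h \<in> S" using that by (simp add: S_def)
    thus "G (A h) = B h" "A h \<in> closure S" using G(2) F[OF that] closure_subset by auto
  qed
  define R where "R = restrict G (closure S)"
  let ?P = "\<lambda>X. X \<in> extensional (closure S) \<and> continuous_on (closure S) X \<and> (\<forall>h\<in>D. X (A h) = B h)"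
  have PR: "?P R"
    using Gc GA by (auto simp: R_def cong: continuous_on_cong)
  have uniq: "X = R" if X: "?P X" for X
  proof (rule extensionalityI)
    fix x assume x: "x \<in> closure S"
    have "X x = G x"
      by (rule G(3)) (use X x F in \<open>auto simp: S_def\<close>)
    thus "X x = R x" using x by (simp add: R_def)
  qed (use X in \<open>auto simp: R_def\<close>)
  show "\<exists>!X. X \<in> extensional (L0 C D V) \<and> continuous_on (L0 C D V) X \<and>
    (\<forall>h\<in>D. X (orth_proj (ker_adjoint D V) (C h)) = orth_proj (orth_compl D) (C (V h)))"
    using PR uniq unfolding L0 K_def[symmetric] A_def[symmetric] B_def[symmetric] by blast
  have "X0 C D V = (THE X. ?P X)"
    by (simp add: X0_def L0 A_def B_def K_def)
  also have "\<dots> = R" using PR uniq by (rule the_equality)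
  finally have X0: "X0 C D V = R" .
  show "X0 C D V (orth_proj (ker_adjoint D V) (C h)) = orth_proj (orth_compl D) (C (V h))"
    if "h \<in> D" for h
    using PR that unfolding X0 by (simp add: A_def B_def K_def)
  have R: "R x = G x" if "x \<in> closure S" for x using that by (simp add: R_def)
  have seq: "\<exists>h. (\<forall>n. h n \<in> D) \<and> (\<lambda>n. A (h n)) \<longlonglongrightarrow> x \<and> (\<lambda>n. B (h n)) \<longlonglongrightarrow> R x"
    if x: "x \<in> closure S" for x
  proof -
    obtain s where s: "\<And>n. s n \<in> S" "s \<longlonglongrightarrow> x" using x closure_sequential by metis
    then obtain h where h: "\<And>n. h n \<in> D" "\<And>n. s n = A (h n)"
      unfolding S_def image_iff by metis
    have "(\<lambda>n. G (s n)) \<longlonglongrightarrow> G x"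
      by (rule continuous_on_tendsto_compose[OF Gc s(2) x])
         (simp add: h(2) GA(2)[OF h(1)])
    hence "(\<lambda>n. B (h n)) \<longlonglongrightarrow> R x" by (simp only: h(2) GA(1)[OF h(1)] R[OF x])
    moreover have "s = (\<lambda>n. A (h n))" using h(2) by (rule ext)
    hence "(\<lambda>n. A (h n)) \<longlonglongrightarrow> x" using s(2) by simp
    ultimately show ?thesis using h(1) by blast
  qed
  have lim: "x \<in> closure S \<and> R x = y"
    if h: "\<And>n. h n \<in> D" "(\<lambda>n. A (h n)) \<longlonglongrightarrow> x" "(\<lambda>n. B (h n)) \<longlonglongrightarrow> y" for h x y
  proof -
    have x: "x \<in> closure S"
      unfolding closure_sequential
      by (rule exI[of _ "\<lambda>n. A (h n)"]) (use h(1,2) in \<open>auto simp: S_def\<close>)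
    have "(\<lambda>n. G (A (h n))) \<longlonglongrightarrow> G x"
      by (rule continuous_on_tendsto_compose[OF Gc h(2) x]) (simp add: GA(2)[OF h(1)])
    hence "(\<lambda>n. B (h n)) \<longlonglongrightarrow> R x" by (simp only: GA(1)[OF h(1)] R[OF x])
    thus ?thesis using x h(3) LIMSEQ_unique by blast
  qed
  have add: "x + y \<in> closure S \<and> R (x + y) = R x + R y"
    if xy: "x \<in> closure S" "y \<in> closure S" for x y
  proof -
    obtain h k where h: "\<And>n. h n \<in> D" "(\<lambda>n. A (h n)) \<longlonglongrightarrow> x" "(\<lambda>n. B (h n)) \<longlonglongrightarrow> R x"
      and k: "\<And>n. k n \<in> D" "(\<lambda>n. A (k n)) \<longlonglongrightarrow> y" "(\<lambda>n. B (k n)) \<longlonglongrightarrow> R y"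
      using seq[OF xy(1)] seq[OF xy(2)] by metis
    show ?thesis
      using tendsto_add[OF h(2) k(2)] tendsto_add[OF h(3) k(3)] h(1) k(1)
      by (intro lim[of "\<lambda>n. h n + k n"]) (simp_all add: Aadd Badd Dadd)
  qed
  have sc: "c *\<^sub>C x \<in> closure S \<and> R (c *\<^sub>C x) = c *\<^sub>C R x" if x: "x \<in> closure S" for x c
  proof -
    obtain h where h: "\<And>n. h n \<in> D" "(\<lambda>n. A (h n)) \<longlonglongrightarrow> x" "(\<lambda>n. B (h n)) \<longlonglongrightarrow> R x"
      using seq[OF x] by metis
    show ?thesis
      using bounded_linear.tendsto[OF bounded_linear_scaleC h(2), of c]
        bounded_linear.tendsto[OF bounded_linear_scaleC h(3), of c] h(1)
      by (intro lim[of "\<lambda>n. cnj c *\<^sub>C h n"])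
         (simp_all add: Aadd(2)[OF h(1) h(1)] Badd(2)[OF h(1) h(1)] Dadd(2)[OF h(1) h(1)])
  qed
  have nrm: "norm (R x) = norm x" if x: "x \<in> closure S" for x
  proof -
    obtain h where h: "\<And>n. h n \<in> D" "(\<lambda>n. A (h n)) \<longlonglongrightarrow> x" "(\<lambda>n. B (h n)) \<longlonglongrightarrow> R x"
      using seq[OF x] by metis
    have "(\<lambda>n. norm (A (h n))) = (\<lambda>n. norm (B (h n)))" using nAB h(1) by auto
    thus ?thesis
      using tendsto_norm[OF h(2)] tendsto_norm[OF h(3)] LIMSEQ_unique by metis
  qed
  show "isometric_on (L0 C D V) (X0 C D V)"
    using add sc nrm by (auto simp: X0 L0 isometric_on_def clinear_on_def)
  have z: "0 \<in> closure S"
  proof -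
    have "0 \<in> D" using D by (simp add: closed_csubspace_def)
    from sc[OF GA(2)[OF this], of 0] show ?thesis
      using scaleC_of_real[of 0] by (metis of_real_0 scaleR_zero_left)
  qed
  show "closed_csubspace (L0 C D V)"
    using add sc z by (auto simp: L0 closed_csubspace_def)
  show "X0 C D V ` L0 C D V \<subseteq> orth_compl D"
  proof (clarsimp simp: X0 L0)
    fix x assume "x \<in> closure S"
    then obtain h where h: "(\<lambda>n. B (h n)) \<longlonglongrightarrow> R x" using seq by metis
    have "closed (orth_compl D)" using closed_csubspace_orth_compl by (auto simp: closed_csubspace_def)
    thus "R x \<in> orth_compl D" using closed_sequentially[OF _ _ h] BD by blast
  qed
  show "L0 C D V \<subseteq> ker_adjoint D V"
    unfolding L0 K_def[symmetric]
    by (rule closure_minimal) (use AK K(1) in \<open>auto simp: S_def closed_csubspace_def\<close>)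
qed

end

theory Submission
  imports Defs
begin

text \<open>
  Write \<open>D\<close> for the domain of \<open>V\<close>.  For a unitary \<open>U\<close> put \<open>Q = C U\<close>.  Then \<open>U\<close> is
  \<open>C\<close>-self-adjoint if and only if \<open>Q\<close> is a conjugation of the whole space
  (\<open>unitary_C_self_adjoint_iff_conjugation\<close>), so the \<open>C\<close>-self-adjoint unitary extensions of \<open>V\<close>
  correspond to the conjugations \<open>Q\<close> with \<open>Q h = C V h\<close> for \<open>h \<in> D\<close>.  Such a \<open>Q\<close> satisfies
  \<open>Q C V h = h\<close> as well, so it is determined on the closed span of \<open>D\<close> and \<open>C V D\<close> and maps the
  orthogonal complement \<open>N\<close> of this span onto itself.  What remains free is the conjugation \<open>J\<close>
  that \<open>Q\<close> induces on \<open>N\<close>.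

  The complement \<open>N\<close> is the kernel of \<open>X\<^sub>0\<^sup>*\<close> in \<open>D\<^sup>\<perp>\<close> (\<open>N_iff\<close>).  The operator \<open>V_ext C D V J\<close> sends
  \<open>h \<in> D\<close> to \<open>V h\<close>, \<open>C V h\<close> to \<open>C h\<close>, and \<open>n \<in> N\<close> to \<open>C J n\<close>: for the second of these, the projections
  of \<open>C V h\<close> to \<open>D\<close> and \<open>D\<^sup>\<perp>\<close> are \<open>V\<^sup>* C h\<close> and \<open>X\<^sub>0 P C h\<close>, with \<open>P\<close> the projection to \<open>ker V\<^sup>*\<close>, and
  they go to the two parts \<open>V V\<^sup>* C h\<close> and \<open>P C h\<close> of \<open>C h\<close>.  It is also a contraction, because its
  summands take values in mutually orthogonal subspaces (\<open>norm_V_ext_le\<close>).  Hence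
  \<open>C \<circ> V_ext C D V J\<close> is an involution; as a nonexpansive involution it is isometric, that is, a conjugation
  (\<open>conjugation_V_ext\<close>).  This gives the bijection.

  If \<open>C D\<^sup>\<perp> \<inter> ker V\<^sup>* = {0}\<close>, then \<open>N = {0}\<close> and a contraction is determined by its values on \<open>D\<close> and
  \<open>C V D\<close>.  A contractive extension \<open>W\<close> of the pair has \<open>W\<^sup>* C h = C V h\<close>, a vector of the same norm
  as \<open>C h\<close>; the equality case of \<open>\<parallel>W\<parallel> \<le> 1\<close> forces \<open>W C V h = W W\<^sup>* C h = C h\<close>
  (\<open>contractive_extension_CV\<close>), so there is only one.
\<close>

section \<open>Projections, adjoints and conjugations\<close>

lemma cinner_eq_0_commute: "cinner x y = 0 \<longleftrightarrow> cinner y (x::'a::complex_inner) = 0"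
  by (metis cinner_commute complex_cnj_zero)

lemma scaleC_zero_right: "c *\<^sub>C 0 = (0::'a::complex_inner)"
  using scaleC_diff_right[of c 0 0] by simp

lemma orth_complD:
  assumes "x \<in> orth_compl M" "y \<in> M"
  shows "cinner x y = 0" "cinner y x = 0"
  using assms cinner_eq_0_commute[of x y] by (auto simp: orth_compl_def)

lemma orth_complI: "(\<And>y. y \<in> M \<Longrightarrow> cinner y x = 0) \<Longrightarrow> x \<in> orth_compl M"
  using cinner_eq_0_commute by (fastforce simp: orth_compl_def)

lemma orth_compl_Int: "x \<in> M \<Longrightarrow> x \<in> orth_compl M \<Longrightarrow> x = (0::'a::complex_inner)"
  by (auto simp: orth_compl_def dest: bspec[of _ _ x])

lemma orth_compl_closure: "orth_compl (closure S) = orth_compl (S::'a::complex_inner set)"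
proof
  show "orth_compl S \<subseteq> orth_compl (closure S)"
  proof
    fix x assume x: "x \<in> orth_compl S"
    have "closed ((\<lambda>y. cinner y x) -` {0})"
      by (intro closed_vimage continuous_on_cinner_left) auto
    moreover have "S \<subseteq> (\<lambda>y. cinner y x) -` {0}"
      using orth_complD(2)[OF x] by auto
    ultimately have "closure S \<subseteq> (\<lambda>y. cinner y x) -` {0}" by (rule closure_minimal[rotated])
    thus "x \<in> orth_compl (closure S)"
      by (intro orth_complI) blast
  qed
  show "orth_compl (closure S) \<subseteq> orth_compl S"
    using closure_subset by (fastforce simp: orth_compl_def)
qed

lemma clinear_on_orth_proj:
  fixes M :: "'a::chilbert_space set"
  assumes M: "closed_csubspace M"
  shows "clinear_on UNIV (orth_proj M)"
proof -
  note p = orth_proj_props[OF M] and M' = M[unfolded closed_csubspace_def]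
  note o = closed_csubspace_orth_compl[of M, unfolded closed_csubspace_def]
  have "orth_proj M (x + y) = orth_proj M x + orth_proj M y" for x y
  proof (rule orth_proj_eq[OF M])
    show "x + y - (orth_proj M x + orth_proj M y) \<in> orth_compl M"
      using o p(2)[of x] p(2)[of y] by (metis add_diff_add)
  qed (use M' p in auto)
  moreover have "orth_proj M (c *\<^sub>C x) = c *\<^sub>C orth_proj M x" for c x
    by (rule orth_proj_eq[OF M]) (use M' p o in \<open>auto simp flip: scaleC_diff_right\<close>)
  ultimately show ?thesis by (simp add: clinear_on_def)
qed

lemma orth_proj_in_eq: "closed_csubspace M \<Longrightarrow> x \<in> M \<Longrightarrow> orth_proj M x = x"
  by (rule orth_proj_eq) (simp_all add: orth_compl_def)

lemma orth_proj_eq_0: "closed_csubspace M \<Longrightarrow> x \<in> orth_compl M \<Longrightarrow> orth_proj M x = 0"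
  by (rule orth_proj_eq) (simp_all add: closed_csubspace_def)

lemma orth_proj_orth_compl:
  fixes M :: "'a::chilbert_space set"
  assumes M: "closed_csubspace M"
  shows "orth_proj (orth_compl M) x = x - orth_proj M x"
proof (rule orth_proj_eq[OF closed_csubspace_orth_compl])
  show "x - (x - orth_proj M x) \<in> orth_compl (orth_compl M)"
    by (rule orth_complI) (simp add: orth_complD(1)[OF _ orth_proj_props(1)[OF M]])
qed (rule orth_proj_props(2)[OF M])

lemma norm_orth_proj_Pythagoras:
  fixes M :: "'a::chilbert_space set"
  assumes M: "closed_csubspace M"
  shows "(norm x)\<^sup>2 = (norm (orth_proj M x))\<^sup>2 + (norm (x - orth_proj M x))\<^sup>2"
proof -
  have "cinner (orth_proj M x) (x - orth_proj M x) = 0"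
    using orth_complD(2) orth_proj_props[OF M] by blast
  from orth_norm_add[OF this] show ?thesis by simp
qed

lemma clinear_on_adjoint_on:
  fixes D :: "'a::chilbert_space set"
  assumes D: "closed_csubspace D" and T: "clinear_on D T" "\<forall>x\<in>D. norm (T x) \<le> K * norm x"
  shows "clinear_on UNIV (adjoint_on D T)"
proof -
  note a = adjoint_on_props[OF D T]
  have "adjoint_on D T (x + y) = adjoint_on D T x + adjoint_on D T y" for x y
    by (rule adjoint_on_eq[OF D])
       (use D a in \<open>auto simp: cinner_add_right closed_csubspace_def\<close>)
  moreover have "adjoint_on D T (c *\<^sub>C x) = c *\<^sub>C adjoint_on D T x" for c x
    by (rule adjoint_on_eq[OF D])
       (use D a in \<open>auto simp: cinner_scaleC_right closed_csubspace_def\<close>)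
  ultimately show ?thesis by (simp add: clinear_on_def)
qed

lemma norm_adjoint_on_le:
  fixes D :: "'a::chilbert_space set"
  assumes D: "closed_csubspace D" and T: "clinear_on D T" "\<forall>x\<in>D. norm (T x) \<le> norm x"
  shows "norm (adjoint_on D T g) \<le> norm g"
proof -
  have T': "\<forall>x\<in>D. norm (T x) \<le> 1 * norm x" using T by simp
  note a = adjoint_on_props[OF D T(1) T']
  let ?y = "adjoint_on D T g"
  have "(norm ?y)\<^sup>2 = Re (cinner ?y ?y)" by (simp add: cinner_self)
  also have "\<dots> = inner (T ?y) g" using a(2)[OF a(1)] by (simp flip: Re_cinner)
  also have "\<dots> \<le> norm (T ?y) * norm g" by (rule norm_cauchy_schwarz)
  also have "\<dots> \<le> norm ?y * norm g" using T a(1) by (intro mult_right_mono) auto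
  finally have "norm ?y * norm ?y \<le> norm ?y * norm g" by (simp add: power2_eq_square)
  thus ?thesis by (cases "norm ?y = 0") auto
qed

lemma continuous_on_additive_nonexpansive:
  fixes T :: "'a::real_normed_vector \<Rightarrow> 'a"
  assumes add: "\<And>x y. T (x + y) = T x + T y" and le: "\<And>x. norm (T x) \<le> norm x"
  shows "continuous_on UNIV T"
proof -
  have "T x - T y = T (x - y)" for x y using add[of "x - y" y] by simp
  hence "dist (T x) (T y) \<le> dist x y" for x y using le by (simp add: dist_norm)
  thus ?thesis unfolding continuous_on_iff by (meson le_less_trans)
qed

lemma conjugation_UNIV:
  assumes "conjugation_on UNIV (Q :: 'a::complex_inner \<Rightarrow> 'a)"
  shows "Q (x + y) = Q x + Q y" "Q (c *\<^sub>C x) = cnj c *\<^sub>C Q x" "norm (Q x) = norm x" "Q (Q x) = x"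
    "Q 0 = 0" "cinner (Q x) (Q y) = cinner y x" "cinner (Q x) y = cinner (Q y) x"
proof -
  show "Q (x + y) = Q x + Q y" "Q (c *\<^sub>C x) = cnj c *\<^sub>C Q x" "norm (Q x) = norm x"
    and inv: "Q (Q x) = x" for x y c
    using assms by (auto simp: conjugation_on_def antilinear_on_def)
  show "Q 0 = 0"
    using assms unfolding conjugation_on_def by (metis UNIV_I norm_eq_zero)
  show iso: "cinner (Q x) (Q y) = cinner y x" for x y
    using conjugation_on_cinner[OF closed_csubspace_UNIV assms] by simp
  show "cinner (Q x) y = cinner (Q y) x" using iso[of x "Q y"] by (simp add: inv)
qed

text \<open>For a unitary \<open>U\<close> the equation \<open>U = C U\<^sup>* C\<close> says \<open>(C U)\<inverse> = U\<inverse> C = U\<^sup>* C = C U\<close>, so that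
  composition with \<open>C\<close> turns the \<open>C\<close>-self-adjoint unitaries into the involutive antilinear
  isometries.\<close>

lemma unitary_C_self_adjoint_iff_conjugation:
  fixes C U :: "'a::chilbert_space \<Rightarrow> 'a"
  assumes C: "conjugation_on UNIV C"
  shows "unitary U \<and> C_self_adjoint C U \<longleftrightarrow> conjugation_on UNIV (C \<circ> U)"
proof
  note c = conjugation_UNIV[OF C]
  assume "unitary U \<and> C_self_adjoint C U"
  hence U: "isometric_on UNIV U" and s: "\<And>x. U x = C (adjoint_on UNIV U (C x))"
    by (auto simp: unitary_def C_self_adjoint_def dest: fun_cong)
  have "adjoint_on UNIV U (U x) = x" for x
    by (rule adjoint_on_eq[OF closed_csubspace_UNIV])
       (simp_all add: isometric_on_cinner[OF closed_csubspace_UNIV U])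
  hence "C (U (C (U x))) = x" for x using s[of "C (U x)"] by (simp add: c)
  thus "conjugation_on UNIV (C \<circ> U)"
    using U by (simp add: conjugation_on_def antilinear_on_def isometric_on_def clinear_on_def c)
next
  note c = conjugation_UNIV[OF C]
  assume Q: "conjugation_on UNIV (C \<circ> U)"
  note q = conjugation_UNIV[OF Q, unfolded o_def]
  have add: "U (x + y) = U x + U y" for x y using q(1)[of x y] by (metis c(1,4))
  have sc: "U (k *\<^sub>C x) = k *\<^sub>C U x" for k x
    using arg_cong[OF q(2)[of k x], of C] by (simp add: c)
  have nrm: "norm (U x) = norm x" for x using q(3)[of x] by (simp add: c)
  have iso: "isometric_on UNIV U"
    by (simp add: isometric_on_def clinear_on_def add sc nrm)
  have "U (C (U (C y))) = y" for y using arg_cong[OF q(4)[of "C y"], of C] by (simp add: c)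
  hence "surj U" by (metis surjI[of U "\<lambda>y. C (U (C y))"])
  moreover have "bounded_operator U"
    unfolding bounded_operator_def using iso
    by (auto simp: isometric_on_def intro!: exI[of _ 1])
  moreover have adj: "adjoint_on UNIV U g = C (U (C g))" for g
  proof (rule adjoint_on_eq[OF closed_csubspace_UNIV])
    have "cinner (U f) g = cinner f (C (U (C g)))" for f
      by (metis c(4,6) q(4,6))
    thus "\<forall>f\<in>UNIV. cinner (U f) g = cinner f (C (U (C g)))" by simp
  qed simp
  ultimately show "unitary U \<and> C_self_adjoint C U"
    using iso by (auto simp: unitary_def C_self_adjoint_def c fun_eq_iff)
qed

section \<open>The subspace on which an extension is free\<close>

locale C_symmetric_isometry =
  fixes C V :: "'a::chilbert_space \<Rightarrow> 'a" and D :: "'a set"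
  assumes C: "conjugation_on UNIV C"
    and D: "closed_csubspace D"
    and V: "isometric_on D V"
    and sym: "C_symmetric_on C D V"
begin

abbreviation "K \<equiv> ker_adjoint D V"
abbreviation "N \<equiv> ker_X0_adj C D V"
abbreviation "X \<equiv> X0_adj C D V"
text \<open>\<open>X\<^sub>0\<close> is the continuous extension of \<open>A h \<mapsto> B h\<close>.\<close>

abbreviation "A h \<equiv> orth_proj K (C h)"
abbreviation "B h \<equiv> orth_proj (orth_compl D) (C (V h))"

lemmas c = conjugation_UNIV[OF C]
lemmas X0_props = X0_ex1[OF C D V sym]

lemma V_props:
  "\<lbrakk>x \<in> D; y \<in> D\<rbrakk> \<Longrightarrow> V (x + y) = V x + V y" "x \<in> D \<Longrightarrow> V (k *\<^sub>C x) = k *\<^sub>C V x"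
  "x \<in> D \<Longrightarrow> norm (V x) = norm x" "clinear_on D V" "\<forall>x\<in>D. norm (V x) \<le> 1 * norm x"
  using V by (auto simp: isometric_on_def clinear_on_def)

lemma X0_bound: "clinear_on (L0 C D V) (X0 C D V)"
    "\<forall>x\<in>L0 C D V. norm (X0 C D V x) \<le> 1 * norm x"
  using X0_props(2) by (auto simp: isometric_on_def)

lemma K_eq: "K = orth_compl (V ` D)"
  by (rule ker_adjoint_eq[OF D V])

lemma closed_K: "closed_csubspace K"
  unfolding K_eq by (rule closed_csubspace_orth_compl)

lemma orth_compl_L0: "orth_compl (L0 C D V) = orth_compl (A ` D)"
  unfolding L0_def by (rule orth_compl_closure)

text \<open>Because \<open>V\<close> is isometric, \<open>V V\<^sup>*\<close> is the projection onto the range of \<open>V\<close>.\<close>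

lemma A_eq: "A h = C h - V (adjoint_on D V (C h))"
proof (rule orth_proj_eq[OF closed_K])
  note a = adjoint_on_props[OF D V_props(4,5)]
  have "cinner (V f) (C h - V (adjoint_on D V (C h))) = 0" if "f \<in> D" for f
    using isometric_on_cinner[OF D V that a(1)] a(2)[OF that] by (simp add: cinner_diff_right)
  thus "C h - V (adjoint_on D V (C h)) \<in> K"
    unfolding K_eq by (intro orth_complI) auto
  show "C h - (C h - V (adjoint_on D V (C h))) \<in> orth_compl K"
    unfolding K_eq by (rule orth_complI) (simp add: orth_complD(1)[OF _ imageI[OF a(1)]])
qed

text \<open>Here \<open>C\<close>-symmetry enters: \<open>(f, C V h) = (V f, C h) = (f, V\<^sup>* C h)\<close> for \<open>f \<in> D\<close>.\<close>

lemma orth_proj_D_CV: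
  assumes h: "h \<in> D"
  shows "orth_proj D (C (V h)) = adjoint_on D V (C h)"
proof (rule orth_proj_eq[OF D])
  note a = adjoint_on_props[OF D V_props(4,5)]
  show "adjoint_on D V (C h) \<in> D" by (rule a(1))
  have "cinner f (C (V h) - adjoint_on D V (C h)) = 0" if "f \<in> D" for f
    using sym h that a(2)[OF that, of "C h"] by (simp add: C_symmetric_on_def cinner_diff_right)
  thus "C (V h) - adjoint_on D V (C h) \<in> orth_compl D"
    by (rule orth_complI)
qed

lemma A_in_L0: "h \<in> D \<Longrightarrow> A h \<in> L0 C D V"
  unfolding L0_def by (rule subsetD[OF closure_subset]) simp

lemma X_B: "h \<in> D \<Longrightarrow> X (B h) = A h"
  unfolding X0_adj_def
proof (rule adjoint_on_eq[OF X0_props(5)])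
  assume h: "h \<in> D"
  thus A: "A h \<in> L0 C D V" by (rule A_in_L0)
  show "\<forall>f\<in>L0 C D V. cinner (X0 C D V f) (B h) = cinner f (A h)"
    using isometric_on_cinner[OF X0_props(5,2) _ A] unfolding X0_props(6)[OF h] by blast
qed

lemma X_in_L0: "X u \<in> L0 C D V"
  unfolding X0_adj_def using adjoint_on_props(1)[OF X0_props(5) X0_bound] .

lemma X_0: "X 0 = 0"
  unfolding X0_adj_def
  by (rule adjoint_on_eq[OF X0_props(5)]) (use X0_props(5) in \<open>auto simp: closed_csubspace_def\<close>)

lemma cinner_A_X: "h \<in> D \<Longrightarrow> cinner (A h) (X g) = cinner (B h) g"
proof -
  assume h: "h \<in> D"
  from adjoint_on_props(2)[OF X0_props(5) X0_bound A_in_L0[OF h], of g] show ?thesis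
    unfolding X0_adj_def X0_props(6)[OF h] by simp
qed

text \<open>The kernel of \<open>X\<^sub>0\<^sup>*\<close> is the part of \<open>D\<^sup>\<perp>\<close> orthogonal to the range of \<open>X\<^sub>0\<close>.  The
  vectors \<open>B h = X\<^sub>0 (A h)\<close> are dense in this range, and \<open>(B h, g) = (C V h, g)\<close> for \<open>g \<perp> D\<close>.\<close>

lemma N_iff: "g \<in> N \<longleftrightarrow> (\<forall>h\<in>D. cinner g h = 0) \<and> (\<forall>h\<in>D. cinner g (C (V h)) = 0)"
proof (cases "g \<in> orth_compl D")
  case True
  have "cinner (B h) g = cinner (C (V h)) g" for h
    unfolding orth_proj_orth_compl[OF D]
    using orth_complD(2)[OF True orth_proj_props(1)[OF D]] by (simp add: cinner_diff_left)
  hence *: "cinner (A h) (X g) = cinner (C (V h)) g" if "h \<in> D" for h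
    using cinner_A_X[OF that] by simp
  have "X g = 0 \<longleftrightarrow> (\<forall>h\<in>D. cinner (C (V h)) g = 0)"
  proof
    assume "\<forall>h\<in>D. cinner (C (V h)) g = 0"
    hence "X g \<in> orth_compl (L0 C D V)"
      unfolding orth_compl_L0 by (intro orth_complI) (auto simp: * )
    thus "X g = 0" by (rule orth_compl_Int[OF X_in_L0])
  qed (use * in fastforce)
  thus ?thesis
    using True cinner_eq_0_commute[of g] by (auto simp: ker_X0_adj_def orth_compl_def)
qed (auto simp: ker_X0_adj_def orth_compl_def)

lemma N_eq: "N = orth_compl (D \<union> (\<lambda>h. C (V h)) ` D)"
  by (auto simp: N_iff orth_compl_def)

lemma closed_N: "closed_csubspace N"
  unfolding N_eq by (rule closed_csubspace_orth_compl)

lemma C_in_K_iff: "C g \<in> K \<longleftrightarrow> (\<forall>h\<in>D. cinner g (C (V h)) = 0)"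
proof -
  have "cinner (C g) (V h) = 0 \<longleftrightarrow> cinner g (C (V h)) = 0" for h
    using c(7)[of g "V h"] cinner_eq_0_commute[of g "C (V h)"] by simp
  thus ?thesis unfolding K_eq by (simp add: orth_compl_def)
qed

lemma N_eq_Int: "N = orth_compl D \<inter> C ` K"
proof -
  have "g \<in> C ` K \<longleftrightarrow> (\<forall>h\<in>D. cinner g (C (V h)) = 0)" for g
    unfolding C_in_K_iff[symmetric] by (metis c(4) image_iff)
  hence "g \<in> N \<longleftrightarrow> g \<in> orth_compl D \<inter> C ` K" for g
    unfolding N_iff Int_iff by (simp add: orth_compl_def)
  thus ?thesis by blast
qed

text \<open>\<open>D\<close>, \<open>C V D\<close> and \<open>N\<close> together span a dense subspace, since \<open>N\<close> is the orthogonal complement of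
  the first two; an equality between contractions need only be checked on these three sets.\<close>

lemma in_closed_csubspace_if_contains:
  assumes S: "closed_csubspace S" and "D \<subseteq> S" "\<And>h. h \<in> D \<Longrightarrow> C (V h) \<in> S" "N \<subseteq> S"
  shows "x \<in> S"
proof -
  have "x - orth_proj S x \<in> orth_compl S" by (rule orth_proj_props(2)[OF S])
  moreover from this have "x - orth_proj S x \<in> N"
    using assms by (fastforce simp: N_iff orth_compl_def)
  ultimately have "x - orth_proj S x = 0" using assms orth_compl_Int by blast
  thus ?thesis using orth_proj_props(1)[OF S, of x] by simp
qed

lemma contraction_eqI:
  assumes "contraction T" "contraction U"
    and "\<And>f. f \<in> D \<Longrightarrow> T f = U f" "\<And>h. h \<in> D \<Longrightarrow> T (C (V h)) = U (C (V h))"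
    and "\<And>n. n \<in> N \<Longrightarrow> T n = U n"
  shows "T = U"
proof
  fix x
  have lin: "S (x + y) = S x + S y" "S (k *\<^sub>C x) = k *\<^sub>C S x" "continuous_on UNIV S"
    if "contraction S" for S :: "'a \<Rightarrow> 'a" and x y k
    using that continuous_on_additive_nonexpansive[of S]
    by (auto simp: contraction_def clinear_on_def)
  have "closed {x. T x = U x}"
    using lin(3)[OF assms(1)] lin(3)[OF assms(2)] by (rule closed_Collect_eq)
  moreover have "T 0 = U 0" using assms(3) D by (auto simp: closed_csubspace_def)
  ultimately have "closed_csubspace {x. T x = U x}"
    using lin(1,2)[OF assms(1)] lin(1,2)[OF assms(2)] by (simp add: closed_csubspace_def)
  from in_closed_csubspace_if_contains[OF this, of x] assms(3-) show "T x = U x" by auto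
qed

section \<open>The extension determined by a conjugation\<close>

text \<open>\<open>C N\<close> is the room that \<open>L\<^sub>0\<close> leaves in \<open>ker V\<^sup>*\<close>: on \<open>ker V\<^sup>*\<close>, being orthogonal to \<open>A h\<close> is
  the same as being orthogonal to \<open>C h\<close>, and \<open>(C n, C h) = (h, n) = 0\<close> for \<open>n \<in> N\<close>.\<close>

lemma C_N_orth_L0:
  assumes n: "n \<in> N"
  shows "C n \<in> orth_compl (L0 C D V)"
proof -
  have K: "C n \<in> K" using n by (simp add: N_iff C_in_K_iff)
  have "cinner (C n) (A h) = 0" if h: "h \<in> D" for h
  proof -
    have "cinner (C n) (C h - A h) = 0"
      using orth_proj_props(2)[OF closed_K] K by (rule orth_complD(2))
    hence "cinner (C n) (A h) = cinner h n" by (simp add: cinner_diff_right c)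
    also have "\<dots> = 0" using n h cinner_eq_0_commute[of h n] by (simp add: N_iff)
    finally show ?thesis .
  qed
  thus ?thesis unfolding orth_compl_L0 by (auto simp: orth_compl_def)
qed

context
  fixes J
  assumes J: "conjugation_on N J"
begin

lemma J_props:
  "x \<in> N \<Longrightarrow> J x \<in> N" "\<lbrakk>x \<in> N; y \<in> N\<rbrakk> \<Longrightarrow> J (x + y) = J x + J y"
  "x \<in> N \<Longrightarrow> J (k *\<^sub>C x) = cnj k *\<^sub>C J x" "x \<in> N \<Longrightarrow> norm (J x) = norm x"
  "x \<in> N \<Longrightarrow> J (J x) = x" "J 0 = 0"
proof -
  have "0 \<in> N" using closed_N by (simp add: closed_csubspace_def)
  thus "J 0 = 0" using J unfolding conjugation_on_def by (metis norm_eq_zero)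
qed (use J in \<open>auto simp: conjugation_on_def antilinear_on_def\<close>)

lemma clinear_V_ext: "clinear_on UNIV (V_ext C D V J)"
proof -
  note pD = clinear_on_orth_proj[OF D] and pN = clinear_on_orth_proj[OF closed_N]
    and pM = clinear_on_orth_proj[OF closed_csubspace_orth_compl[of D]]
    and x = clinear_on_adjoint_on[OF X0_props(5) X0_bound]
  show ?thesis
    using pD pN pM x orth_proj_props(1)[OF D] orth_proj_props(1)[OF closed_N]
    by (simp add: clinear_on_def V_ext_def Let_def X0_adj_def V_props J_props c scaleC_add_right)
qed

text \<open>The three summands of \<open>V_ext C D V J x\<close> lie in the mutually orthogonal subspaces \<open>V D\<close>, \<open>L\<^sub>0\<close>
  and \<open>C N\<close>, and \<open>X\<^sub>0\<^sup>*\<close> does not see the component of its argument in \<open>N\<close>.\<close>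

lemma norm_V_ext_le: "norm (V_ext C D V J x) \<le> norm x"
proof -
  define f u n where "f = orth_proj D x" and "u = orth_proj (orth_compl D) x" and "n = orth_proj N u"
  have f: "f \<in> D" and n: "n \<in> N"
    using orth_proj_props(1)[OF D] orth_proj_props(1)[OF closed_N] by (auto simp: f_def n_def)
  have "X (u - n) + X n = X u"
    using clinear_on_adjoint_on[OF X0_props(5) X0_bound]
    unfolding X0_adj_def clinear_on_def by (metis UNIV_I diff_add_cancel)
  hence "X u = X (u - n)" using n by (simp add: ker_X0_adj_def)
  hence Xle: "(norm (X u))\<^sup>2 \<le> (norm (u - n))\<^sup>2"
    using norm_adjoint_on_le[OF X0_props(5) X0_bound(1), of "u - n"] X0_bound(2)
    by (simp add: X0_adj_def)
  have K: "X u + C (J n) \<in> K"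
    using X_in_L0[of u] X0_props(4) J_props(1)[OF n] closed_K
    by (auto simp: closed_csubspace_def N_iff C_in_K_iff)
  have "cinner (V f) (X u + C (J n)) = 0"
    using K f orth_complD(2) unfolding K_eq by blast
  from orth_norm_add[OF this]
  have "(norm (V_ext C D V J x))\<^sup>2 = (norm f)\<^sup>2 + (norm (X u + C (J n)))\<^sup>2"
    using f by (simp add: V_ext_def Let_def V_props flip: f_def u_def n_def)
  also have "(norm (X u + C (J n)))\<^sup>2 = (norm (X u))\<^sup>2 + (norm n)\<^sup>2"
  proof -
    have "cinner (X u) (C (J n)) = 0"
      using C_N_orth_L0[OF J_props(1)[OF n]] X_in_L0 by (rule orth_complD(2))
    from orth_norm_add[OF this] show ?thesis using n by (simp add: c J_props)
  qed
  also have "(norm f)\<^sup>2 + ((norm (X u))\<^sup>2 + (norm n)\<^sup>2) \<le> (norm f)\<^sup>2 + (norm u)\<^sup>2"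
    using Xle norm_orth_proj_Pythagoras[OF closed_N, of u] by (simp add: n_def)
  also have "\<dots> = (norm x)\<^sup>2"
    using norm_orth_proj_Pythagoras[OF D, of x] by (simp add: f_def u_def orth_proj_orth_compl[OF D])
  finally show ?thesis by (simp add: power2_le_iff_abs_le)
qed

lemma contraction_V_ext: "contraction (V_ext C D V J)"
  using clinear_V_ext norm_V_ext_le by (simp add: contraction_def)

lemma V_ext_D:
  assumes "f \<in> D" shows "V_ext C D V J f = V f"
proof -
  have "orth_proj N 0 = 0"
    using closed_N by (intro orth_proj_in_eq) (auto simp: closed_csubspace_def)
  thus ?thesis using assms
    by (simp add: V_ext_def Let_def orth_proj_orth_compl[OF D] orth_proj_in_eq[OF D] X_0 J_props c)
qed

lemma V_ext_N:
  assumes n: "n \<in> N" shows "V_ext C D V J n = C (J n)"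
proof -
  have o: "n \<in> orth_compl D" and x: "X n = 0" using n by (auto simp: ker_X0_adj_def)
  have "V 0 = 0" using V_props(3)[of 0] D by (simp add: closed_csubspace_def)
  thus ?thesis using n x orth_proj_eq_0[OF D o]
    by (simp add: V_ext_def Let_def orth_proj_orth_compl[OF D] orth_proj_in_eq[OF closed_N])
qed

text \<open>The \<open>N\<close>-term vanishes because \<open>B h = X\<^sub>0 (A h)\<close> lies in the range of \<open>X\<^sub>0\<close>; what is left is the
  decomposition of \<open>C h\<close> along \<open>V D\<close> and \<open>ker V\<^sup>*\<close>.\<close>

lemma V_ext_CV:
  assumes h: "h \<in> D" shows "V_ext C D V J (C (V h)) = C h"
proof -
  have "B h \<in> orth_compl N"
  proof -
    have "cinner (B h) n = 0" if n: "n \<in> N" for n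
      using n cinner_A_X[OF h, of n] by (simp add: ker_X0_adj_def)
    thus ?thesis by (simp add: orth_compl_def)
  qed
  hence "orth_proj N (B h) = 0" by (rule orth_proj_eq_0[OF closed_N])
  thus ?thesis
    by (simp add: V_ext_def Let_def X_B[OF h] orth_proj_D_CV[OF h] A_eq J_props c)
qed

text \<open>\<open>Q = C \<circ> V_ext C D V J\<close> exchanges \<open>h\<close> with \<open>C V h\<close> and restricts to \<open>J\<close> on \<open>N\<close>, so it is an
  involution on the dense span of \<open>D\<close>, \<open>C V D\<close> and \<open>N\<close>, hence everywhere; a
  nonexpansive involution is isometric because \<open>\<parallel>x\<parallel> = \<parallel>Q Q x\<parallel> \<le> \<parallel>Q x\<parallel> \<le> \<parallel>x\<parallel>\<close>.\<close>

lemma conjugation_V_ext: "conjugation_on UNIV (C \<circ> V_ext C D V J)"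
proof -
  define Q where "Q = C \<circ> V_ext C D V J"
  have anti: "Q (x + y) = Q x + Q y" "Q (k *\<^sub>C x) = cnj k *\<^sub>C Q x" for x y k
    using clinear_V_ext by (auto simp: Q_def clinear_on_def c)
  have le: "norm (Q x) \<le> norm x" for x using norm_V_ext_le by (simp add: Q_def c)
  have QQ: "contraction (Q \<circ> Q)"
    using anti order_trans[OF le le] by (simp add: contraction_def clinear_on_def)
  have "contraction (id :: 'a \<Rightarrow> 'a)" by (simp add: contraction_def clinear_on_def)
  hence "Q \<circ> Q = id"
    by (rule contraction_eqI[OF QQ])
       (simp_all add: Q_def V_ext_D V_ext_CV V_ext_N J_props c)
  hence inv: "Q (Q x) = x" for x by (metis comp_apply id_apply)
  have "norm (Q x) = norm x" for x using le[of x] le[of "Q x"] by (simp add: inv)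
  thus ?thesis using anti inv
    by (simp add: conjugation_on_def antilinear_on_def flip: Q_def)
qed

end

text \<open>A conjugation extending \<open>C V\<close> maps \<open>D\<close> onto \<open>C V D\<close> and back, hence preserves the common
  orthogonal complement \<open>N\<close>.  This is why every extension comes from some \<open>J\<close>.\<close>

lemma conjugation_restrict_N:
  assumes Q: "conjugation_on UNIV Q" and ext: "\<And>f. f \<in> D \<Longrightarrow> Q f = C (V f)"
  shows "conjugation_on N (restrict Q N)"
proof -
  note q = conjugation_UNIV[OF Q]
  have N: "Q n \<in> N" if n: "n \<in> N" for n
  proof -
    have "cinner (Q n) h = 0" "cinner (Q n) (C (V h)) = 0" if h: "h \<in> D" for h
      using n h q(7)[of n h] q(6)[of n h] cinner_eq_0_commute[of _ n]
      by (auto simp: N_iff ext)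
    thus ?thesis by (simp add: N_iff)
  qed
  thus ?thesis using closed_N
    by (auto simp: conjugation_on_def antilinear_on_def q closed_csubspace_def)
qed

lemma bij_betw_V_ext:
  "bij_betw (V_ext C D V) {J \<in> extensional N. conjugation_on N J}
     {U. unitary U \<and> C_self_adjoint C U \<and> (\<forall>f\<in>D. U f = V f)}"
  unfolding bij_betw_def
proof (intro conjI equalityI subsetI)
  show "inj_on (V_ext C D V) {J \<in> extensional N. conjugation_on N J}"
  proof (rule inj_onI, clarify)
    fix I J assume I: "I \<in> extensional N" "conjugation_on N I"
      and J: "J \<in> extensional N" "conjugation_on N J" and eq: "V_ext C D V I = V_ext C D V J"
    show "I = J"
    proof (rule extensionalityI[OF I(1) J(1)])
      fix n assume "n \<in> N"
      hence "C (I n) = C (J n)" using V_ext_N[OF I(2)] V_ext_N[OF J(2)] eq by metis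
      thus "I n = J n" by (metis c(4))
    qed
  qed
next
  fix U assume "U \<in> V_ext C D V ` {J \<in> extensional N. conjugation_on N J}"
  thus "U \<in> {U. unitary U \<and> C_self_adjoint C U \<and> (\<forall>f\<in>D. U f = V f)}"
    using unitary_C_self_adjoint_iff_conjugation[OF C] conjugation_V_ext V_ext_D by auto
next
  fix U assume "U \<in> {U. unitary U \<and> C_self_adjoint C U \<and> (\<forall>f\<in>D. U f = V f)}"
  hence U: "isometric_on UNIV U" "\<And>f. f \<in> D \<Longrightarrow> U f = V f"
    and Q: "conjugation_on UNIV (C \<circ> U)"
    using unitary_C_self_adjoint_iff_conjugation[OF C] by (auto simp: unitary_def)
  define J where "J = restrict (C \<circ> U) N"
  have J: "conjugation_on N J"
    unfolding J_def using U(2) by (intro conjugation_restrict_N[OF Q]) simp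
  have "V_ext C D V J = U"
  proof (rule contraction_eqI[OF contraction_V_ext[OF J]])
    show "contraction U" using U(1) by (simp add: contraction_def isometric_on_def)
    show "V_ext C D V J n = U n" if "n \<in> N" for n
      using that V_ext_N[OF J that] by (simp add: J_def c)
    fix h assume h: "h \<in> D"
    show "V_ext C D V J h = U h" using V_ext_D[OF J h] U(2)[OF h] by simp
    have "C (U (C (V h))) = h" using conjugation_UNIV(4)[OF Q, of h] U(2)[OF h] by simp
    hence "U (C (V h)) = C h" by (metis c(4))
    thus "V_ext C D V J (C (V h)) = U (C (V h))" using V_ext_CV[OF J h] by simp
  qed
  moreover have "J \<in> extensional N" by (simp add: J_def)
  ultimately show "U \<in> V_ext C D V ` {J \<in> extensional N. conjugation_on N J}"
    using J by blast
qed

section \<open>Uniqueness of the contractive extension\<close>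

text \<open>With \<open>g = C V h = W\<^sup>* C h\<close> one has \<open>(W g, C h) = \<parallel>g\<parallel>\<^sup>2\<close> and \<open>\<parallel>C h\<parallel> = \<parallel>g\<parallel>\<close>, whence
  \<open>\<parallel>W g - C h\<parallel>\<^sup>2 = \<parallel>W g\<parallel>\<^sup>2 - \<parallel>g\<parallel>\<^sup>2 \<le> 0\<close>.\<close>

lemma contractive_extension_CV:
  assumes W: "contractive_extension D V (C ` D) (C \<circ> V \<circ> C) W" and h: "h \<in> D"
  shows "W (C (V h)) = C h"
proof -
  have lin: "clinear_on UNIV W" and le: "\<And>x. norm (W x) \<le> norm x"
    using W by (auto simp: contractive_extension_def contraction_def)
  have b: "\<forall>x\<in>UNIV. norm (W x) \<le> 1 * norm x" using le by simp
  define g where "g = C (V h)"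
  have "adjoint_on UNIV W (C h) = g"
    using W h by (simp add: contractive_extension_def c g_def)
  hence "cinner (W g) (C h) = cinner g g"
    using adjoint_on_props(2)[OF closed_csubspace_UNIV lin b, of g "C h"] by simp
  hence "inner (W g) (C h) = (norm g)\<^sup>2"
    by (simp add: cinner_self flip: Re_cinner)
  moreover have "inner (C h) (C h) = inner g g"
    using h by (simp add: g_def c V_props flip: power2_norm_eq_inner)
  moreover have "(norm (W g))\<^sup>2 \<le> (norm g)\<^sup>2" using le by (simp add: power_mono)
  ultimately have "(norm (W g - C h))\<^sup>2 \<le> 0"
    by (simp add: power2_norm_eq_inner inner_diff_left inner_diff_right inner_commute)
  thus ?thesis by (simp add: g_def)
qed

lemma C_self_adjoint_adjoint_on:
  assumes "C_self_adjoint C U"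
  shows "adjoint_on UNIV U (C h) = C (U h)"
proof -
  have "U h = C (adjoint_on UNIV U (C h))"
    using assms unfolding C_self_adjoint_def by (metis comp_apply)
  thus ?thesis by (simp add: c)
qed

lemma unique_contractive_extension:
  assumes 0: "C ` orth_compl D \<inter> K = {0}"
  defines "W \<equiv> \<lambda>x. V (orth_proj D x) + X (orth_proj (orth_compl D) x)"
  shows "unitary W" "C_self_adjoint C W" "contractive_extension D V (C ` D) (C \<circ> V \<circ> C) W"
    "contractive_extension D V (C ` D) (C \<circ> V \<circ> C) W' \<Longrightarrow> W' = W"
proof -
  have N: "N = {0}"
  proof -
    have "n = 0" if "n \<in> N" for n
    proof -
      from that have "C n \<in> C ` orth_compl D \<inter> K" by (auto simp: N_eq_Int c)
      hence "C n = 0" using 0 by blast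
      thus "n = 0" by (metis c(3) norm_eq_zero)
    qed
    thus ?thesis using closed_N by (auto simp: closed_csubspace_def)
  qed
  \<comment> \<open>The trivial space has exactly one conjugation, and its extension is \<open>W\<close>.\<close>
  define J where "J = restrict (\<lambda>x. 0 :: 'a) N"
  have J: "J \<in> extensional N" "conjugation_on N J"
    by (auto simp: J_def N conjugation_on_def antilinear_on_def scaleC_zero_right)
  have "V_ext C D V J = W"
    using orth_proj_props(1)[OF closed_N] by (simp add: fun_eq_iff V_ext_def W_def Let_def J_def c)
  with bij_betw_apply[OF bij_betw_V_ext] J
  have W: "unitary W" "C_self_adjoint C W" "\<And>f. f \<in> D \<Longrightarrow> W f = V f" by fastforce+
  thus "unitary W" "C_self_adjoint C W" by simp_all
  have "contraction W" using W(1) by (simp add: contraction_def unitary_def isometric_on_def)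
  thus ext: "contractive_extension D V (C ` D) (C \<circ> V \<circ> C) W"
    using W(3) C_self_adjoint_adjoint_on[OF W(2)] by (auto simp: contractive_extension_def c)
  assume ext': "contractive_extension D V (C ` D) (C \<circ> V \<circ> C) W'"
  show "W' = W"
  proof (rule contraction_eqI)
    show "contraction W'" "contraction W"
      using ext ext' by (simp_all add: contractive_extension_def)
    show "W' f = W f" if "f \<in> D" for f
      using ext ext' that by (simp add: contractive_extension_def)
    show "W' (C (V h)) = W (C (V h))" if "h \<in> D" for h
      using contractive_extension_CV[OF ext that] contractive_extension_CV[OF ext' that] by simp
    show "W' n = W n" if "n \<in> N" for n
      using that D ext ext' by (simp add: N contractive_extension_def closed_csubspace_def)
  qed
qed

end

theorem theorem4p2:
  fixes C V :: "'a::chilbert_space \<Rightarrow> 'a" and HV :: "'a set"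
  assumes "conjugation_on UNIV C"
    and "closed_csubspace HV"
    and "isometric_on HV V"
    and "C_symmetric_on C HV V"
  shows "ker_X0_adj C HV V = orth_compl HV \<inter> C ` ker_adjoint HV V
    \<and> bij_betw (V_ext C HV V)
        {J \<in> extensional (ker_X0_adj C HV V). conjugation_on (ker_X0_adj C HV V) J}
        {U. unitary U \<and> C_self_adjoint C U \<and> (\<forall>f\<in>HV. U f = V f)}
    \<and> (C ` orth_compl HV \<inter> ker_adjoint HV V = {0} \<longrightarrow>
        (let W = (\<lambda>x. V (orth_proj HV x) + X0_adj C HV V (orth_proj (orth_compl HV) x)) in
           unitary W \<and> C_self_adjoint C W
           \<and> contractive_extension HV V (C ` HV) (C \<circ> V \<circ> C) W
           \<and> (\<forall>W'. contractive_extension HV V (C ` HV) (C \<circ> V \<circ> C) W' \<longrightarrow> W' = W)))"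
proof -
  interpret C_symmetric_isometry C V HV
    using assms by unfold_locales
  show ?thesis
    unfolding Let_def using N_eq_Int bij_betw_V_ext unique_contractive_extension by blast
qed

end
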